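(* The residuated lattices based on $\mathbf{M}_X$, for $X$ a set, are precisely the ones of the form $\mathbf{R}_{\mathbf{A},\mathbf{B}}$, where $\mathbf{A}$ is a $\top$-cancellative monoid with zero $\top$ and $\mathbf{B}$ is a semigroup with zero $\bot$, disjoint from $A$, whose multiplication is one of the following four: (i) $B=\{\bot\}$; (ii) $B=\{\bot,b\}$ with $b^2=b$; (iii) $B=\{\bot,b\}$ with $b^2=\bot$; (iv) $B=\{\bot,b_1,b_2\}$ with $b_1^2=b_1$, $b_2^2=b_2$, $b_1b_2=b_2b_1=\bot$.
   Context: A residuated lattice is an algebra $(R,\wedge,\vee,\cdot,\backslash,/,1)$ such that $(R,\wedge,\vee)$ is a lattice, $(R,\cdot,1)$ is a monoid, and for all $x,y,z\in R$: $xy\le z \iff y\le x\backslash z \iff x\le z/y$. The divisions are uniquely determined by the order and multiplication, so a lattice-ordered monoid expands to a residuated lattice in at most one way. For a set $X$, $\mathbf{M}_X$ is the lattice on $X\cup\{\bot,\top\}$ ($\bot\neq\top$, neither in $X$) with top $\top$, bottom $\bot$, and $x\vee y=\top$, $x\wedge y=\bot$ for distinct $x,y\in X$. A residuated lattice is "based on $\mathbf{M}_X$" if $\mathbf{M}_X$ is its lattice reduct. A monoid with zero (absorbing element) $\top$ is $\top$-cancellative if for all $x,y,z$: $xy=xz\neq\top$ implies $y=z$, and $yx=zx\neq\top$ implies $y=z$. In each of the four semigroups $\mathbf{B}$, $\bot$ is absorbing. $\mathbf{R}_{\mathbf{A},\mathbf{B}}$ has underlying set $R=A\cup B$, the lattice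 structure $\mathbf{M}_X$ with $X=R\setminus\{\bot,\top\}$, bottom $\bot$ and top $\top$, the multiplication that extends those of $\mathbf{A}$ and $\mathbf{B}$ by $xy=yx=y$ for all $x\in A$, $y\in B$, and the identity of $\mathbf{A}$ as $1$; it is regarded as a residuated lattice via its unique expansion by divisions. *)

theory Defs
  imports "HOL-Algebra.Group"
begin

section \<open>Residuated lattices\<close>

text \<open>
  As usual in HOL-Algebra, a lattice is given by its carrier and its order; the operations
  join and meet of an algebra $(R, \wedge, \vee, \ldots)$ are the derived \<open>\<squnion>\<close> and \<open>\<sqinter>\<close>.
\<close>

record 'a ordered_monoid = "'a gorder" +
  fuse :: "['a, 'a] \<Rightarrow> 'a" (infixl \<open>\<odot>\<index>\<close> 70)
  unit :: 'a (\<open>\<e>\<index>\<close>)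

text \<open>\<open>ldiv R x z\<close> is $x \backslash z$ and \<open>rdiv R z y\<close> is $z / y$.\<close>

record 'a residuated = "'a ordered_monoid" +
  ldiv :: "['a, 'a] \<Rightarrow> 'a"
  rdiv :: "['a, 'a] \<Rightarrow> 'a"

definition monoid_reduct :: "('a, 'b) ordered_monoid_scheme \<Rightarrow> 'a monoid" where
  "monoid_reduct R = \<lparr>carrier = carrier R, mult = fuse R, one = unit R\<rparr>"

locale residuated_lattice = lattice R
  for R :: "('a, 'b) residuated_scheme" (structure) +
  assumes monoid_reduct: "monoid (monoid_reduct R)"
    and ldiv_closed: "\<lbrakk>x \<in> carrier R; z \<in> carrier R\<rbrakk> \<Longrightarrow> ldiv R x z \<in> carrier R"
    and rdiv_closed: "\<lbrakk>z \<in> carrier R; y \<in> carrier R\<rbrakk> \<Longrightarrow> rdiv R z y \<in> carrier R"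
    and ldiv_residual: "\<lbrakk>x \<in> carrier R; y \<in> carrier R; z \<in> carrier R\<rbrakk>
          \<Longrightarrow> x \<odot> y \<sqsubseteq> z \<longleftrightarrow> y \<sqsubseteq> ldiv R x z"
    and rdiv_residual: "\<lbrakk>x \<in> carrier R; y \<in> carrier R; z \<in> carrier R\<rbrakk>
          \<Longrightarrow> x \<odot> y \<sqsubseteq> z \<longleftrightarrow> x \<sqsubseteq> rdiv R z y"

text \<open>
  The only candidates for the divisions: $x \backslash z$ has to be the greatest $y$ with
  $xy \le z$, and $z / y$ the greatest $x$ with $xy \le z$. If such a maximum does not exist,
  the value is arbitrary and the result is not a residuated lattice.
\<close>

definition expand_by_divisions :: "'a ordered_monoid \<Rightarrow> 'a residuated" where
  "expand_by_divisions L =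
     \<lparr>carrier = carrier L, eq = eq L, le = le L, fuse = fuse L, unit = unit L,
      ldiv = (\<lambda>x z. THE y. greatest L y {y \<in> carrier L. x \<odot>\<^bsub>L\<^esub> y \<sqsubseteq>\<^bsub>L\<^esub> z}),
      rdiv = (\<lambda>z y. THE x. greatest L x {x \<in> carrier L. x \<odot>\<^bsub>L\<^esub> y \<sqsubseteq>\<^bsub>L\<^esub> z})\<rparr>"

text \<open>
  Equality of algebras. The operations are total functions on the type, so their values
  outside the carrier have to be disregarded.
\<close>

definition same_algebra :: "'a residuated \<Rightarrow> 'a residuated \<Rightarrow> bool" where
  "same_algebra R S \<longleftrightarrow>
     carrier R = carrier S \<and> eq R = eq S \<and> unit R = unit S \<and>
     (\<forall>x \<in> carrier R. \<forall>y \<in> carrier R.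
        (x \<sqsubseteq>\<^bsub>R\<^esub> y \<longleftrightarrow> x \<sqsubseteq>\<^bsub>S\<^esub> y) \<and> x \<odot>\<^bsub>R\<^esub> y = x \<odot>\<^bsub>S\<^esub> y \<and>
        ldiv R x y = ldiv S x y \<and> rdiv R x y = rdiv S x y)"


section \<open>The lattices $\mathbf{M}_X$\<close>

definition M_lattice :: "'a set \<Rightarrow> 'a \<Rightarrow> 'a \<Rightarrow> 'a gorder" where
  "M_lattice X bt tp =
     \<lparr>carrier = X \<union> {bt, tp}, eq = (=), le = (\<lambda>x y. x = y \<or> x = bt \<or> y = tp)\<rparr>"

definition based_on_M :: "'a set \<Rightarrow> 'a \<Rightarrow> 'a \<Rightarrow> 'a residuated \<Rightarrow> bool" where
  "based_on_M X bt tp R \<longleftrightarrow>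
     bt \<noteq> tp \<and> bt \<notin> X \<and> tp \<notin> X \<and>
     carrier R = carrier (M_lattice X bt tp) \<and>
     (\<forall>x \<in> carrier R. \<forall>y \<in> carrier R. x \<sqsubseteq>\<^bsub>R\<^esub> y \<longleftrightarrow> x \<sqsubseteq>\<^bsub>M_lattice X bt tp\<^esub> y)"

text \<open>
  The order above is that of the lattice on $X \cup \{\bot, \top\}$ with bottom $\bot$, top $\top$,
  and $x \vee y = \top$, $x \wedge y = \bot$ for distinct $x, y \in X$.
\<close>

context
  fixes X :: "'a set" and bt tp :: 'a
  assumes M: "bt \<noteq> tp" "bt \<notin> X" "tp \<notin> X"
begin

lemma M_least: "least (M_lattice X bt tp) bt (carrier (M_lattice X bt tp))"
  and M_greatest: "greatest (M_lattice X bt tp) tp (carrier (M_lattice X bt tp))"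
  by (auto simp: least_def greatest_def M_lattice_def)

lemma M_partial_order: "partial_order (M_lattice X bt tp)"
  using M by unfold_locales (auto simp: M_lattice_def)

lemma M_lub:
  assumes "x \<in> X" "y \<in> X" "x \<noteq> y"
  shows "least (M_lattice X bt tp) tp (Upper (M_lattice X bt tp) {x, y})"
  using M assms by (auto simp: least_def Upper_def M_lattice_def)

lemma M_glb:
  assumes "x \<in> X" "y \<in> X" "x \<noteq> y"
  shows "greatest (M_lattice X bt tp) bt (Lower (M_lattice X bt tp) {x, y})"
  using M assms by (auto simp: greatest_def Lower_def M_lattice_def)

lemma M_is_lattice: "lattice (M_lattice X bt tp)"
proof -
  interpret partial_order "M_lattice X bt tp" by (rule M_partial_order)
  show ?thesis
  proof unfold_locales
    fix x y assume xy: "x \<in> carrier (M_lattice X bt tp)" "y \<in> carrier (M_lattice X bt tp)"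
    have "least (M_lattice X bt tp)
            (if x = y \<or> x = bt then y else if y = bt then x else tp)
            (Upper (M_lattice X bt tp) {x, y})"
      using xy M by (auto simp: least_def Upper_def M_lattice_def)
    then show "\<exists>s. least (M_lattice X bt tp) s (Upper (M_lattice X bt tp) {x, y})" ..
    have "greatest (M_lattice X bt tp)
            (if x = y \<or> x = tp then y else if y = tp then x else bt)
            (Lower (M_lattice X bt tp) {x, y})"
      using xy M by (auto simp: greatest_def Lower_def M_lattice_def)
    then show "\<exists>s. greatest (M_lattice X bt tp) s (Lower (M_lattice X bt tp) {x, y})" ..
  qed
qed

lemma M_join:
  assumes "x \<in> X" "y \<in> X" "x \<noteq> y"
  shows "x \<squnion>\<^bsub>M_lattice X bt tp\<^esub> y = tp"
proof -
  interpret lattice "M_lattice X bt tp" by (rule M_is_lattice)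
  have "least (M_lattice X bt tp) (x \<squnion>\<^bsub>M_lattice X bt tp\<^esub> y) (Upper (M_lattice X bt tp) {x, y})"
    unfolding join_def sup_def by (rule someI, rule M_lub[OF assms])
  then show ?thesis
    using M_lub[OF assms] by (rule least_unique)
qed

lemma M_meet:
  assumes "x \<in> X" "y \<in> X" "x \<noteq> y"
  shows "x \<sqinter>\<^bsub>M_lattice X bt tp\<^esub> y = bt"
proof -
  interpret lattice "M_lattice X bt tp" by (rule M_is_lattice)
  have "greatest (M_lattice X bt tp) (x \<sqinter>\<^bsub>M_lattice X bt tp\<^esub> y) (Lower (M_lattice X bt tp) {x, y})"
    unfolding meet_def inf_def by (rule someI, rule M_glb[OF assms])
  then show ?thesis
    using M_glb[OF assms] by (rule greatest_unique)
qed

lemma M_unique: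
  assumes "lattice L" "carrier L = X \<union> {bt, tp}"
    and "least L bt (carrier L)" "greatest L tp (carrier L)"
    and join: "\<And>x y. \<lbrakk>x \<in> X; y \<in> X; x \<noteq> y\<rbrakk> \<Longrightarrow> x \<squnion>\<^bsub>L\<^esub> y = tp"
    and xy: "x \<in> carrier L" "y \<in> carrier L"
  shows "x \<sqsubseteq>\<^bsub>L\<^esub> y \<longleftrightarrow> x \<sqsubseteq>\<^bsub>M_lattice X bt tp\<^esub> y"
proof -
  interpret lattice L by fact
  have bounds: "bt \<sqsubseteq>\<^bsub>L\<^esub> z" "z \<sqsubseteq>\<^bsub>L\<^esub> tp" if "z \<in> carrier L" for z
    using that assms(3,4) by (auto simp: least_def greatest_def)
  have "x = y \<or> x = bt \<or> y = tp" if le: "x \<sqsubseteq>\<^bsub>L\<^esub> y"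
  proof (rule ccontr)
    assume c: "\<not> (x = y \<or> x = bt \<or> y = tp)"
    have "x \<noteq> tp" using c le bounds[of y] xy le_antisym by metis
    moreover have "y \<noteq> bt" using c le bounds[of x] xy le_antisym by metis
    ultimately have "x \<in> X" "y \<in> X" "x \<noteq> y" using c xy assms(2) by auto
    then have "x \<squnion>\<^bsub>L\<^esub> y = tp" by (rule join)
    moreover have "x \<squnion>\<^bsub>L\<^esub> y = y" using iffD1[OF le_iff_meet[OF xy] le] by simp
    ultimately show False using c by simp
  qed
  then show ?thesis using bounds xy by (auto simp: M_lattice_def)
qed

end


section \<open>The algebras $\mathbf{R}_{\mathbf{A},\mathbf{B}}$\<close>

definition top_cancellative_monoid :: "'a monoid \<Rightarrow> 'a \<Rightarrow> bool" where
  "top_cancellative_monoid A tp \<longleftrightarrow>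
     monoid A \<and> tp \<in> carrier A \<and>
     (\<forall>x \<in> carrier A. x \<otimes>\<^bsub>A\<^esub> tp = tp \<and> tp \<otimes>\<^bsub>A\<^esub> x = tp) \<and>
     (\<forall>x \<in> carrier A. \<forall>y \<in> carrier A. \<forall>z \<in> carrier A.
        (x \<otimes>\<^bsub>A\<^esub> y = x \<otimes>\<^bsub>A\<^esub> z \<and> x \<otimes>\<^bsub>A\<^esub> z \<noteq> tp \<longrightarrow> y = z) \<and>
        (y \<otimes>\<^bsub>A\<^esub> x = z \<otimes>\<^bsub>A\<^esub> x \<and> z \<otimes>\<^bsub>A\<^esub> x \<noteq> tp \<longrightarrow> y = z))"

record 'a sgroup = "'a partial_object" +
  smult :: "['a, 'a] \<Rightarrow> 'a" (infixl \<open>\<star>\<index>\<close> 70)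

definition semigroup_with_zero :: "'a sgroup \<Rightarrow> 'a \<Rightarrow> bool" where
  "semigroup_with_zero B bt \<longleftrightarrow>
     (\<forall>x \<in> carrier B. \<forall>y \<in> carrier B. x \<star>\<^bsub>B\<^esub> y \<in> carrier B) \<and>
     (\<forall>x \<in> carrier B. \<forall>y \<in> carrier B. \<forall>z \<in> carrier B.
        (x \<star>\<^bsub>B\<^esub> y) \<star>\<^bsub>B\<^esub> z = x \<star>\<^bsub>B\<^esub> (y \<star>\<^bsub>B\<^esub> z)) \<and>
     bt \<in> carrier B \<and>
     (\<forall>x \<in> carrier B. x \<star>\<^bsub>B\<^esub> bt = bt \<and> bt \<star>\<^bsub>B\<^esub> x = bt)"

definition one_of_four :: "'a sgroup \<Rightarrow> 'a \<Rightarrow> bool" where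
  "one_of_four B bt \<longleftrightarrow>
     carrier B = {bt} \<or>
     (\<exists>b. b \<noteq> bt \<and> carrier B = {bt, b} \<and> b \<star>\<^bsub>B\<^esub> b = b) \<or>
     (\<exists>b. b \<noteq> bt \<and> carrier B = {bt, b} \<and> b \<star>\<^bsub>B\<^esub> b = bt) \<or>
     (\<exists>b\<^sub>1 b\<^sub>2. b\<^sub>1 \<noteq> bt \<and> b\<^sub>2 \<noteq> bt \<and> b\<^sub>1 \<noteq> b\<^sub>2 \<and> carrier B = {bt, b\<^sub>1, b\<^sub>2} \<and>
        b\<^sub>1 \<star>\<^bsub>B\<^esub> b\<^sub>1 = b\<^sub>1 \<and> b\<^sub>2 \<star>\<^bsub>B\<^esub> b\<^sub>2 = b\<^sub>2 \<and> b\<^sub>1 \<star>\<^bsub>B\<^esub> b\<^sub>2 = bt \<and> b\<^sub>2 \<star>\<^bsub>B\<^esub> b\<^sub>1 = bt)"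

definition R_monoid :: "'a monoid \<Rightarrow> 'a sgroup \<Rightarrow> 'a \<Rightarrow> 'a \<Rightarrow> 'a ordered_monoid" where
  "R_monoid A B bt tp =
     (let R = carrier A \<union> carrier B; L = M_lattice (R - {bt, tp}) bt tp in
      \<lparr>carrier = R, eq = eq L, le = le L,
       fuse = (\<lambda>x y. if x \<in> carrier A
                     then (if y \<in> carrier A then x \<otimes>\<^bsub>A\<^esub> y else y)
                     else (if y \<in> carrier A then x else x \<star>\<^bsub>B\<^esub> y)),
       unit = \<one>\<^bsub>A\<^esub>\<rparr>)"

definition R_algebra :: "'a monoid \<Rightarrow> 'a sgroup \<Rightarrow> 'a \<Rightarrow> 'a \<Rightarrow> 'a residuated" where
  "R_algebra A B bt tp = expand_by_divisions (R_monoid A B bt tp)"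

end

theory Submission
  imports Defs
begin

text \<open>
  In a residuated lattice on $\mathbf{M}_X$ every multiplication $y \mapsto xy$ or $y \mapsto yx$
  is a residuated map. Distinct elements other than $\bot$ join to $\top$, so for a map $f$ of
  $\mathbf{M}_X$ this means that $f(\bot) = \bot$, that $f(\top)$ bounds all values, and that
  $f(\top) \le z$ as soon as $f(y), f(y') \le z$ for two distinct $y, y' \ne \bot$
  (\<open>residuated_map_on_M\<close> for the construction, \<open>fuse_bt\<close>, \<open>fuse_le_tp\<close> and
  \<open>fuse_tp_le\<close> for the decomposition). Everything is read off from these three conditions.

  Given such a residuated lattice, $x \le x\top$ leaves only $x\top = \top$ or $x\top = x$; let
  $A$ consist of the elements of the first kind and $B$ of the others. If
  $x \ne 1$ and $x, 1 \ne \bot$, then $\top = x \vee 1$, so both $x\top$ and $\top x$ equal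
  $x^2 \vee x$; hence $\top$ is central (\<open>tp_central\<close>) and the definition of $A$ is left-right
  symmetric. For $a \in A$ and $b \in B$ we have $ab \le \top b = b$ and
  $\top(ab) = (\top a)b = b$, which excludes $ab = \bot$ unless $b = \bot$; so $ab = b$, and
  likewise $ba = b$ (\<open>A_fuse_B\<close>). If $xy = xy'$ in $A$ with $y \ne y'$, then $xy$ bounds
  $x\top = \top$: this is $\top$-cancellativity (\<open>top_cancellative_A\<close>). For $x, y \in B$ the
  product $xy$ lies below both $x\top = x$ and $\top y = y$, so products of distinct elements
  vanish and $x^2 \in \{x, \bot\}$; and $x \ne \bot$ cannot annihilate two distinct nonzero elements
  of $B$, since it would annihilate $\top$. So $B$ has at most two nonzero elements, and if there
  are two of them, both are idempotent (\<open>one_of_four_B\<close>).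

  Conversely, the multiplications of $\mathbf{R}_{\mathbf{A},\mathbf{B}}$ satisfy the three
  conditions: for $x \in A$ the last one comes from $\top$-cancellativity, and for nonzero
  $x \in B$ from the fact that of two distinct nonzero elements of $B$ at least one does not
  annihilate $x$, which is visible in the four tables (\<open>left_residuals\<close>,
  \<open>right_residuals\<close>). The divisions agree because the order and the multiplication determine
  them (\<open>same_algebra_expand_by_divisions\<close>).
\<close>

section \<open>Uniqueness of the expansion by divisions\<close>

text \<open>
  The notions of least upper and greatest lower bound only see the order on the carrier, whereas
  the record field is a relation on the whole type.
\<close>

lemma lattice_cong:
  assumes "lattice S" and car: "carrier R = carrier S" and eq: "eq R = eq S"
    and le: "\<And>x y. \<lbrakk>x \<in> carrier S; y \<in> carrier S\<rbrakk> \<Longrightarrow> x \<sqsubseteq>\<^bsub>R\<^esub> y \<longleftrightarrow> x \<sqsubseteq>\<^bsub>S\<^esub> y"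
  shows "lattice R"
proof -
  interpret S: lattice S by fact
  have up: "least R s (Upper R {x, y}) \<longleftrightarrow> least S s (Upper S {x, y})"
    and low: "greatest R s (Lower R {x, y}) \<longleftrightarrow> greatest S s (Lower S {x, y})"
    if "x \<in> carrier S" "y \<in> carrier S" for s x y
    using that by (auto simp: least_def Upper_def greatest_def Lower_def car le)
  interpret R: partial_order R
  proof
    show "(.=\<^bsub>R\<^esub>) = (=)" by (simp add: eq S.eq_is_equal)
  qed (auto simp: car eq le S.eq_is_equal intro: S.le_trans S.le_antisym)
  show ?thesis
    by unfold_locales (auto simp: car up low intro: S.sup_of_two_exists S.inf_of_two_exists)
qed

text \<open>
  Connects the residuation law with the description of the divisions as maxima.
\<close>

lemma residual_is_the_greatest:
  assumes "partial_order L" and "g \<in> carrier L"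
    and "\<And>y. y \<in> carrier L \<Longrightarrow> P y \<longleftrightarrow> y \<sqsubseteq>\<^bsub>L\<^esub> g"
  shows "(THE y. greatest L y {y \<in> carrier L. P y}) = g"
proof -
  interpret partial_order L by fact
  have "greatest L g {y \<in> carrier L. P y}"
    using assms by (auto simp: greatest_def)
  then show ?thesis
    by (blast intro: the_equality greatest_unique)
qed

lemma residuated_lattice_expand_by_divisions:
  assumes "lattice L" and "monoid (monoid_reduct L)"
    and left: "\<And>x z. \<lbrakk>x \<in> carrier L; z \<in> carrier L\<rbrakk> \<Longrightarrow>
      \<exists>g \<in> carrier L. \<forall>y \<in> carrier L. x \<odot>\<^bsub>L\<^esub> y \<sqsubseteq>\<^bsub>L\<^esub> z \<longleftrightarrow> y \<sqsubseteq>\<^bsub>L\<^esub> g"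
    and right: "\<And>y z. \<lbrakk>y \<in> carrier L; z \<in> carrier L\<rbrakk> \<Longrightarrow>
      \<exists>g \<in> carrier L. \<forall>x \<in> carrier L. x \<odot>\<^bsub>L\<^esub> y \<sqsubseteq>\<^bsub>L\<^esub> z \<longleftrightarrow> x \<sqsubseteq>\<^bsub>L\<^esub> g"
  shows "residuated_lattice (expand_by_divisions L)"
proof -
  let ?E = "expand_by_divisions L"
  interpret L: lattice L by fact
  interpret E: lattice ?E
    by (rule lattice_cong[OF \<open>lattice L\<close>]) (auto simp: expand_by_divisions_def)
  have ldiv: "ldiv ?E x z \<in> carrier L \<and>
      (\<forall>y \<in> carrier L. x \<odot>\<^bsub>L\<^esub> y \<sqsubseteq>\<^bsub>L\<^esub> z \<longleftrightarrow> y \<sqsubseteq>\<^bsub>L\<^esub> ldiv ?E x z)"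
    if xz: "x \<in> carrier L" "z \<in> carrier L" for x z
  proof -
    obtain g where g: "g \<in> carrier L" "\<And>y. y \<in> carrier L \<Longrightarrow> x \<odot>\<^bsub>L\<^esub> y \<sqsubseteq>\<^bsub>L\<^esub> z \<longleftrightarrow> y \<sqsubseteq>\<^bsub>L\<^esub> g"
      using left[OF xz] by blast
    have "ldiv ?E x z = g"
      using residual_is_the_greatest[OF L.partial_order_axioms g]
      by (simp add: expand_by_divisions_def)
    with g show ?thesis by blast
  qed
  have rdiv: "rdiv ?E z y \<in> carrier L \<and>
      (\<forall>x \<in> carrier L. x \<odot>\<^bsub>L\<^esub> y \<sqsubseteq>\<^bsub>L\<^esub> z \<longleftrightarrow> x \<sqsubseteq>\<^bsub>L\<^esub> rdiv ?E z y)"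
    if yz: "y \<in> carrier L" "z \<in> carrier L" for y z
  proof -
    obtain g where g: "g \<in> carrier L" "\<And>x. x \<in> carrier L \<Longrightarrow> x \<odot>\<^bsub>L\<^esub> y \<sqsubseteq>\<^bsub>L\<^esub> z \<longleftrightarrow> x \<sqsubseteq>\<^bsub>L\<^esub> g"
      using right[OF yz] by blast
    have "rdiv ?E z y = g"
      using residual_is_the_greatest[OF L.partial_order_axioms g]
      by (simp add: expand_by_divisions_def)
    with g show ?thesis by blast
  qed
  have [simp]: "carrier ?E = carrier L" "le ?E = le L" "fuse ?E = fuse L"
    "monoid_reduct ?E = monoid_reduct L"
    by (simp_all add: expand_by_divisions_def monoid_reduct_def)
  show ?thesis
    by (rule residuated_lattice.intro[OF E.lattice_axioms], rule residuated_lattice_axioms.intro)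
      (use assms(2) ldiv rdiv in simp_all)
qed

lemma same_algebra_expand_by_divisions:
  assumes "residuated_lattice R" and "partial_order L"
    and car: "carrier L = carrier R" and eq: "eq L = eq R" and unit: "unit L = unit R"
    and le: "\<And>x y. \<lbrakk>x \<in> carrier R; y \<in> carrier R\<rbrakk> \<Longrightarrow> x \<sqsubseteq>\<^bsub>L\<^esub> y \<longleftrightarrow> x \<sqsubseteq>\<^bsub>R\<^esub> y"
    and fuse: "\<And>x y. \<lbrakk>x \<in> carrier R; y \<in> carrier R\<rbrakk> \<Longrightarrow> x \<odot>\<^bsub>L\<^esub> y = x \<odot>\<^bsub>R\<^esub> y"
  shows "same_algebra R (expand_by_divisions L)"
proof -
  interpret R: residuated_lattice R by fact
  have closed: "x \<odot>\<^bsub>R\<^esub> y \<in> carrier R" if "x \<in> carrier R" "y \<in> carrier R" for x y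
    using monoid.m_closed[OF R.monoid_reduct] that by (simp add: monoid_reduct_def)
  have "ldiv (expand_by_divisions L) x z = ldiv R x z"
    if "x \<in> carrier R" "z \<in> carrier R" for x z
    using that residual_is_the_greatest[OF assms(2),
        of "ldiv R x z" "\<lambda>y. x \<odot>\<^bsub>L\<^esub> y \<sqsubseteq>\<^bsub>L\<^esub> z"]
    by (simp add: expand_by_divisions_def car le fuse closed R.ldiv_closed R.ldiv_residual)
  moreover have "rdiv (expand_by_divisions L) z y = rdiv R z y"
    if "y \<in> carrier R" "z \<in> carrier R" for y z
    using that residual_is_the_greatest[OF assms(2),
        of "rdiv R z y" "\<lambda>x. x \<odot>\<^bsub>L\<^esub> y \<sqsubseteq>\<^bsub>L\<^esub> z"]
    by (simp add: expand_by_divisions_def car le fuse closed R.rdiv_closed R.rdiv_residual)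
  ultimately show ?thesis
    by (auto simp: same_algebra_def) (auto simp: expand_by_divisions_def car eq unit le fuse)
qed

lemma residuated_lattice_same_algebra:
  assumes "residuated_lattice S" and same: "same_algebra R S"
  shows "residuated_lattice R"
proof -
  interpret S: residuated_lattice S by fact
  have car: "carrier R = carrier S" and eq: "eq R = eq S" and unit: "unit R = unit S"
    and op: "\<And>x y. \<lbrakk>x \<in> carrier S; y \<in> carrier S\<rbrakk> \<Longrightarrow>
       (x \<sqsubseteq>\<^bsub>R\<^esub> y \<longleftrightarrow> x \<sqsubseteq>\<^bsub>S\<^esub> y) \<and> x \<odot>\<^bsub>R\<^esub> y = x \<odot>\<^bsub>S\<^esub> y \<and>
       ldiv R x y = ldiv S x y \<and> rdiv R x y = rdiv S x y"
    using same by (auto simp: same_algebra_def)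
  interpret R: lattice R
    by (rule lattice_cong[OF S.lattice_axioms]) (auto simp: car eq op)
  interpret S: monoid "monoid_reduct S" by (rule S.monoid_reduct)
  have closed: "x \<odot>\<^bsub>S\<^esub> y \<in> carrier S" if "x \<in> carrier S" "y \<in> carrier S" for x y
    using S.m_closed that by (simp add: monoid_reduct_def)
  have "monoid (monoid_reduct R)"
    by unfold_locales
      (use S.m_assoc S.l_one S.r_one S.one_closed in
        \<open>auto simp: monoid_reduct_def car unit op closed\<close>)
  then show ?thesis
    by (rule residuated_lattice.intro[OF R.lattice_axioms residuated_lattice_axioms.intro])
      (simp_all add: car op closed S.ldiv_closed S.rdiv_closed
        flip: S.ldiv_residual S.rdiv_residual)
qed


section \<open>Residuated maps on $\mathbf{M}_X$\<close>

text \<open>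
  If \<open>f tp\<close> is not below \<open>z\<close>, then at most one element other than \<open>bt\<close> is sent below \<open>z\<close>;
  this element, or else \<open>bt\<close>, is the residual of \<open>z\<close>.
\<close>

lemma residuated_map_on_M:
  fixes X bt tp
  defines "L \<equiv> M_lattice X bt tp"
  assumes M: "bt \<noteq> tp" "bt \<notin> X" "tp \<notin> X"
    and bot: "f bt = bt"
    and top: "\<And>y. y \<in> carrier L \<Longrightarrow> f y \<sqsubseteq>\<^bsub>L\<^esub> f tp"
    and join: "\<And>y y'. \<lbrakk>y \<in> carrier L; y' \<in> carrier L; y \<noteq> y'; y \<noteq> bt; y' \<noteq> bt;
       f y \<sqsubseteq>\<^bsub>L\<^esub> z; f y' \<sqsubseteq>\<^bsub>L\<^esub> z\<rbrakk> \<Longrightarrow> f tp \<sqsubseteq>\<^bsub>L\<^esub> z"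
  shows "\<exists>g \<in> carrier L. \<forall>y \<in> carrier L. f y \<sqsubseteq>\<^bsub>L\<^esub> z \<longleftrightarrow> y \<sqsubseteq>\<^bsub>L\<^esub> g"
proof -
  have le: "x \<sqsubseteq>\<^bsub>L\<^esub> y \<longleftrightarrow> x = y \<or> x = bt \<or> y = tp" for x y
    by (simp add: L_def M_lattice_def)
  have bt: "bt \<in> carrier L" and tp: "tp \<in> carrier L"
    by (simp_all add: L_def M_lattice_def)
  consider "f tp \<sqsubseteq>\<^bsub>L\<^esub> z"
    | w where "\<not> f tp \<sqsubseteq>\<^bsub>L\<^esub> z" "w \<in> carrier L" "w \<noteq> bt" "f w \<sqsubseteq>\<^bsub>L\<^esub> z"
    | "\<not> f tp \<sqsubseteq>\<^bsub>L\<^esub> z" "\<And>w. \<lbrakk>w \<in> carrier L; w \<noteq> bt\<rbrakk> \<Longrightarrow> \<not> f w \<sqsubseteq>\<^bsub>L\<^esub> z"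
    by blast
  then show ?thesis
  proof cases
    case 1
    then have "f y \<sqsubseteq>\<^bsub>L\<^esub> z" if "y \<in> carrier L" for y
      using top[OF that] M by (auto simp: le)
    then show ?thesis using tp by (auto simp: le)
  next
    case 2
    then have "f y \<sqsubseteq>\<^bsub>L\<^esub> z \<longleftrightarrow> y \<sqsubseteq>\<^bsub>L\<^esub> w" if "y \<in> carrier L" for y
      using join[OF that \<open>w \<in> carrier L\<close>] bot by (auto simp: le)
    then show ?thesis using \<open>w \<in> carrier L\<close> by blast
  next
    case 3
    then have "f y \<sqsubseteq>\<^bsub>L\<^esub> z \<longleftrightarrow> y \<sqsubseteq>\<^bsub>L\<^esub> bt" if "y \<in> carrier L" for y
      using that bot M by (auto simp: le)
    then show ?thesis using bt by blast
  qed
qed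


section \<open>The algebras $\mathbf{R}_{\mathbf{A},\mathbf{B}}$ are residuated lattices\<close>

text \<open>
  What the four tables have in common, and all that residuation needs from them.
\<close>

lemma one_of_four_props:
  assumes "semigroup_with_zero B bt" and "one_of_four B bt"
    and "x \<in> carrier B" "y \<in> carrier B"
  shows one_of_four_comm: "x \<star>\<^bsub>B\<^esub> y = y \<star>\<^bsub>B\<^esub> x"
    and one_of_four_mult: "x \<star>\<^bsub>B\<^esub> y = x \<or> x \<star>\<^bsub>B\<^esub> y = bt"
    and one_of_four_join:
      "\<lbrakk>y' \<in> carrier B; y \<noteq> y'; y \<noteq> bt; y' \<noteq> bt\<rbrakk> \<Longrightarrow> x \<star>\<^bsub>B\<^esub> y = x \<or> x \<star>\<^bsub>B\<^esub> y' = x"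
  using assms unfolding one_of_four_def semigroup_with_zero_def by auto

locale R_construction =
  fixes A :: "'a monoid" and B :: "'a sgroup" and bt tp :: 'a
  assumes A: "top_cancellative_monoid A tp"
    and B: "semigroup_with_zero B bt" and four: "one_of_four B bt"
    and disjoint: "carrier A \<inter> carrier B = {}"
begin

abbreviation "X \<equiv> carrier A \<union> carrier B - {bt, tp}"
abbreviation "M \<equiv> M_lattice X bt tp"
abbreviation "L \<equiv> R_monoid A B bt tp"

sublocale A: monoid A
  using A by (simp add: top_cancellative_monoid_def)

lemma tp_A: "tp \<in> carrier A" and bt_B: "bt \<in> carrier B"
  using A B by (auto simp: top_cancellative_monoid_def semigroup_with_zero_def)

lemma not_in_A: "x \<in> carrier B \<Longrightarrow> x \<notin> carrier A"
  using disjoint by blast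

lemma bt_neq_tp: "bt \<noteq> tp"
  using tp_A bt_B disjoint by blast

lemma zero_A: "x \<in> carrier A \<Longrightarrow> x \<otimes>\<^bsub>A\<^esub> tp = tp" "x \<in> carrier A \<Longrightarrow> tp \<otimes>\<^bsub>A\<^esub> x = tp"
  using A by (auto simp: top_cancellative_monoid_def)

lemma cancel_A:
  assumes "x \<in> carrier A" "y \<in> carrier A" "y' \<in> carrier A" "y \<noteq> y'"
  shows "x \<otimes>\<^bsub>A\<^esub> y = z \<Longrightarrow> x \<otimes>\<^bsub>A\<^esub> y' = z \<Longrightarrow> z = tp"
    and "y \<otimes>\<^bsub>A\<^esub> x = z \<Longrightarrow> y' \<otimes>\<^bsub>A\<^esub> x = z \<Longrightarrow> z = tp"
  using A assms unfolding top_cancellative_monoid_def by metis+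

lemma zero_B: "x \<in> carrier B \<Longrightarrow> x \<star>\<^bsub>B\<^esub> bt = bt" "x \<in> carrier B \<Longrightarrow> bt \<star>\<^bsub>B\<^esub> x = bt"
  and closed_B: "\<lbrakk>x \<in> carrier B; y \<in> carrier B\<rbrakk> \<Longrightarrow> x \<star>\<^bsub>B\<^esub> y \<in> carrier B"
  and assoc_B: "\<lbrakk>x \<in> carrier B; y \<in> carrier B; z \<in> carrier B\<rbrakk> \<Longrightarrow>
     (x \<star>\<^bsub>B\<^esub> y) \<star>\<^bsub>B\<^esub> z = x \<star>\<^bsub>B\<^esub> (y \<star>\<^bsub>B\<^esub> z)"
  using B unfolding semigroup_with_zero_def by auto

lemma carrier_L: "carrier L = carrier A \<union> carrier B"
  and carrier_M: "carrier M = carrier A \<union> carrier B"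
  and le_L: "le L = le M"
  and eq_L: "eq L = eq M"
  using tp_A bt_B by (auto simp: R_monoid_def Let_def M_lattice_def)

lemma le_M: "x \<sqsubseteq>\<^bsub>M\<^esub> y \<longleftrightarrow> x = y \<or> x = bt \<or> y = tp"
  by (simp add: M_lattice_def)

lemma fuse_L: "x \<odot>\<^bsub>L\<^esub> y =
    (if x \<in> carrier A then (if y \<in> carrier A then x \<otimes>\<^bsub>A\<^esub> y else y)
     else (if y \<in> carrier A then x else x \<star>\<^bsub>B\<^esub> y))"
  by (simp add: R_monoid_def Let_def)

lemma lattice_L: "lattice L"
  by (rule lattice_cong[OF M_is_lattice[of bt tp X]])
    (use bt_neq_tp in \<open>auto simp: carrier_L carrier_M le_L eq_L\<close>)

lemma monoid_L: "monoid (monoid_reduct L)"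
proof
  fix x y z
  assume "x \<in> carrier (monoid_reduct L)" "y \<in> carrier (monoid_reduct L)"
    "z \<in> carrier (monoid_reduct L)"
  then have "x \<in> carrier A \<union> carrier B" "y \<in> carrier A \<union> carrier B" "z \<in> carrier A \<union> carrier B"
    by (simp_all add: monoid_reduct_def carrier_L)
  then show "x \<otimes>\<^bsub>monoid_reduct L\<^esub> y \<otimes>\<^bsub>monoid_reduct L\<^esub> z
      = x \<otimes>\<^bsub>monoid_reduct L\<^esub> (y \<otimes>\<^bsub>monoid_reduct L\<^esub> z)"
    by (auto simp: monoid_reduct_def fuse_L A.m_assoc assoc_B closed_B not_in_A)
qed (auto simp: monoid_reduct_def carrier_L fuse_L closed_B not_in_A,
    auto simp: R_monoid_def Let_def)

text \<open>
  The join condition of \<open>residuated_map_on_M\<close> has different reasons in the two parts. For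
  \<open>x \<in> A\<close>, the products \<open>x \<odot> y\<close> and \<open>x \<odot> y'\<close> are not \<open>bt\<close>, and they are distinct or both
  \<open>tp\<close>: inside \<open>A\<close> by cancellation, and otherwise because \<open>x\<close> maps \<open>A\<close> to itself and fixes \<open>B\<close>
  pointwise. So only \<open>tp\<close> bounds both. For \<open>x \<in> B\<close>, one of the two products is already \<open>x\<close>,
  and so is \<open>x \<odot> tp\<close>.
\<close>

lemma left_residuals:
  assumes x: "x \<in> carrier A \<union> carrier B"
  shows "\<exists>g \<in> carrier M. \<forall>y \<in> carrier M. x \<odot>\<^bsub>L\<^esub> y \<sqsubseteq>\<^bsub>M\<^esub> z \<longleftrightarrow> y \<sqsubseteq>\<^bsub>M\<^esub> g"
proof (rule residuated_map_on_M)
  show "x \<odot>\<^bsub>L\<^esub> bt = bt"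
    using x bt_B by (auto simp: fuse_L zero_B not_in_A)
next
  fix y assume "y \<in> carrier M"
  then show "x \<odot>\<^bsub>L\<^esub> y \<sqsubseteq>\<^bsub>M\<^esub> x \<odot>\<^bsub>L\<^esub> tp"
    using x tp_A one_of_four_mult[OF B four, of x y]
    by (auto simp: fuse_L le_M carrier_M zero_A not_in_A)
next
  fix y y' assume y: "y \<in> carrier M" "y' \<in> carrier M" "y \<noteq> y'" "y \<noteq> bt" "y' \<noteq> bt"
    and le: "x \<odot>\<^bsub>L\<^esub> y \<sqsubseteq>\<^bsub>M\<^esub> z" "x \<odot>\<^bsub>L\<^esub> y' \<sqsubseteq>\<^bsub>M\<^esub> z"
  then have y': "y \<in> carrier A \<union> carrier B" "y' \<in> carrier A \<union> carrier B"
    by (simp_all add: carrier_M)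
  show "x \<odot>\<^bsub>L\<^esub> tp \<sqsubseteq>\<^bsub>M\<^esub> z"
  proof (cases "x \<in> carrier A")
    case True
    have "z = tp"
      using True le y(3-5) y' bt_B cancel_A(1)[OF True, of y y' z] A.m_closed[OF True]
      by (auto simp: fuse_L le_M not_in_A split: if_splits dest: not_in_A)
    then show ?thesis by (simp add: le_M)
  next
    case False
    then have "x \<odot>\<^bsub>L\<^esub> y = x \<or> x \<odot>\<^bsub>L\<^esub> y' = x"
      using x y(3-5) y' one_of_four_join[OF B four, of x y y'] by (auto simp: fuse_L)
    then show ?thesis using False le tp_A by (auto simp: fuse_L)
  qed
qed (use bt_neq_tp in auto)

lemma right_residuals:
  assumes x: "x \<in> carrier A \<union> carrier B"
  shows "\<exists>g \<in> carrier M. \<forall>y \<in> carrier M. y \<odot>\<^bsub>L\<^esub> x \<sqsubseteq>\<^bsub>M\<^esub> z \<longleftrightarrow> y \<sqsubseteq>\<^bsub>M\<^esub> g"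
proof (rule residuated_map_on_M)
  show "bt \<odot>\<^bsub>L\<^esub> x = bt"
    using x bt_B by (auto simp: fuse_L zero_B not_in_A)
next
  fix y assume "y \<in> carrier M"
  then show "y \<odot>\<^bsub>L\<^esub> x \<sqsubseteq>\<^bsub>M\<^esub> tp \<odot>\<^bsub>L\<^esub> x"
    using x tp_A one_of_four_mult[OF B four, of x y] one_of_four_comm[OF B four, of x y]
    by (auto simp: fuse_L le_M carrier_M zero_A not_in_A)
next
  fix y y' assume y: "y \<in> carrier M" "y' \<in> carrier M" "y \<noteq> y'" "y \<noteq> bt" "y' \<noteq> bt"
    and le: "y \<odot>\<^bsub>L\<^esub> x \<sqsubseteq>\<^bsub>M\<^esub> z" "y' \<odot>\<^bsub>L\<^esub> x \<sqsubseteq>\<^bsub>M\<^esub> z"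
  then have y': "y \<in> carrier A \<union> carrier B" "y' \<in> carrier A \<union> carrier B"
    by (simp_all add: carrier_M)
  show "tp \<odot>\<^bsub>L\<^esub> x \<sqsubseteq>\<^bsub>M\<^esub> z"
  proof (cases "x \<in> carrier A")
    case True
    have "z = tp"
      using True le y(3-5) y' bt_B cancel_A(2)[OF True, of y y' z] A.m_closed[OF _ True]
      by (auto simp: fuse_L le_M not_in_A split: if_splits dest: not_in_A)
    then show ?thesis by (simp add: le_M)
  next
    case False
    then have "y \<odot>\<^bsub>L\<^esub> x = x \<or> y' \<odot>\<^bsub>L\<^esub> x = x"
      using x y(3-5) y' one_of_four_join[OF B four, of x y y']
        one_of_four_comm[OF B four, of x y] one_of_four_comm[OF B four, of x y']
      by (auto simp: fuse_L)
    then show ?thesis using False le tp_A by (auto simp: fuse_L)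
  qed
qed (use bt_neq_tp in auto)

lemma residuated_lattice_R_algebra: "residuated_lattice (R_algebra A B bt tp)"
  unfolding R_algebra_def
proof (rule residuated_lattice_expand_by_divisions[OF lattice_L monoid_L])
qed (use left_residuals right_residuals in \<open>simp_all add: carrier_L carrier_M le_L\<close>)

lemma based_on_M_R_algebra:
  assumes "same_algebra R (R_algebra A B bt tp)"
  shows "based_on_M X bt tp R"
proof -
  have "carrier (R_algebra A B bt tp) = carrier M" "le (R_algebra A B bt tp) = le M"
    using carrier_L carrier_M le_L by (simp_all add: R_algebra_def expand_by_divisions_def)
  then show ?thesis
    using assms bt_neq_tp by (auto simp: same_algebra_def based_on_M_def)
qed

end


section \<open>Decomposing a residuated lattice based on $\mathbf{M}_X$\<close>

locale M_residuated_lattice = residuated_lattice R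
  for R :: "'a residuated" (structure) +
  fixes X :: "'a set" and bt tp :: 'a
  assumes based: "based_on_M X bt tp R"
begin

lemma bt_neq_tp: "bt \<noteq> tp"
  and bt_closed [simp]: "bt \<in> carrier R" and tp_closed [simp]: "tp \<in> carrier R"
  using based by (auto simp: based_on_M_def M_lattice_def)

lemma le_iff: "\<lbrakk>x \<in> carrier R; y \<in> carrier R\<rbrakk> \<Longrightarrow> x \<sqsubseteq> y \<longleftrightarrow> x = y \<or> x = bt \<or> y = tp"
  using based by (auto simp: based_on_M_def M_lattice_def)

lemma fuse_closed [simp]: "\<lbrakk>x \<in> carrier R; y \<in> carrier R\<rbrakk> \<Longrightarrow> x \<odot> y \<in> carrier R"
  using monoid.m_closed[OF monoid_reduct] by (simp add: monoid_reduct_def)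

lemma fuse_assoc:
  "\<lbrakk>x \<in> carrier R; y \<in> carrier R; z \<in> carrier R\<rbrakk> \<Longrightarrow> x \<odot> y \<odot> z = x \<odot> (y \<odot> z)"
  using monoid.m_assoc[OF monoid_reduct] by (simp add: monoid_reduct_def)

lemma unit_closed [simp]: "\<e> \<in> carrier R"
  and unit_left [simp]: "x \<in> carrier R \<Longrightarrow> \<e> \<odot> x = x"
  and unit_right [simp]: "x \<in> carrier R \<Longrightarrow> x \<odot> \<e> = x"
  using monoid.one_closed[OF monoid_reduct] monoid.l_one[OF monoid_reduct]
    monoid.r_one[OF monoid_reduct] by (simp_all add: monoid_reduct_def)

lemma fuse_bt [simp]:
  assumes x: "x \<in> carrier R"
  shows "x \<odot> bt = bt" "bt \<odot> x = bt"
  using ldiv_residual[OF x bt_closed bt_closed] rdiv_residual[OF bt_closed x bt_closed]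
    ldiv_closed[OF x bt_closed] rdiv_closed[OF bt_closed x] x bt_neq_tp
  by (auto simp: le_iff)

lemma fuse_le_tp:
  assumes x: "x \<in> carrier R" and y: "y \<in> carrier R"
  shows "x \<odot> y \<sqsubseteq> x \<odot> tp" "y \<odot> x \<sqsubseteq> tp \<odot> x"
proof -
  have "tp \<sqsubseteq> ldiv R x (x \<odot> tp)" "tp \<sqsubseteq> rdiv R (tp \<odot> x) x"
    using x ldiv_residual[of x tp "x \<odot> tp"] rdiv_residual[of tp x "tp \<odot> x"] by auto
  then have "ldiv R x (x \<odot> tp) = tp" "rdiv R (tp \<odot> x) x = tp"
    using x bt_neq_tp by (auto simp: le_iff ldiv_closed rdiv_closed)
  then show "x \<odot> y \<sqsubseteq> x \<odot> tp" "y \<odot> x \<sqsubseteq> tp \<odot> x"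
    using x y ldiv_residual[of x y "x \<odot> tp"] rdiv_residual[of y x "tp \<odot> x"]
    by (auto simp: le_iff)
qed

text \<open>
  The division of \<open>z\<close> by \<open>x\<close> lies above the distinct elements \<open>y\<close> and \<open>y'\<close>, hence is \<open>tp\<close>.
\<close>

lemma fuse_tp_le:
  assumes x: "x \<in> carrier R" and z: "z \<in> carrier R"
    and y: "y \<in> carrier R" "y' \<in> carrier R" "y \<noteq> y'" "y \<noteq> bt" "y' \<noteq> bt"
  shows "\<lbrakk>x \<odot> y \<sqsubseteq> z; x \<odot> y' \<sqsubseteq> z\<rbrakk> \<Longrightarrow> x \<odot> tp \<sqsubseteq> z"
    and "\<lbrakk>y \<odot> x \<sqsubseteq> z; y' \<odot> x \<sqsubseteq> z\<rbrakk> \<Longrightarrow> tp \<odot> x \<sqsubseteq> z"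
proof -
  have tp: "g = tp" if "g \<in> carrier R" "y \<sqsubseteq> g" "y' \<sqsubseteq> g" for g
    using that y by (auto simp: le_iff)
  show "x \<odot> tp \<sqsubseteq> z" if "x \<odot> y \<sqsubseteq> z" "x \<odot> y' \<sqsubseteq> z"
    using that tp[of "ldiv R x z"] x y z by (simp add: ldiv_residual ldiv_closed)
  show "tp \<odot> x \<sqsubseteq> z" if "y \<odot> x \<sqsubseteq> z" "y' \<odot> x \<sqsubseteq> z"
    using that tp[of "rdiv R z x"] x y z by (simp add: rdiv_residual rdiv_closed)
qed

lemma fuse_tp_cases:
  assumes x: "x \<in> carrier R"
  shows "x \<odot> tp = x \<or> x \<odot> tp = tp" "tp \<odot> x = x \<or> tp \<odot> x = tp"
  using fuse_le_tp[OF x unit_closed] x by (auto simp: le_iff)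

lemma tp_tp [simp]: "tp \<odot> tp = tp"
  using fuse_tp_cases[of tp] by auto

lemma unit_neq_bt: "\<e> \<noteq> bt"
  using unit_left[OF tp_closed] fuse_bt(2)[OF tp_closed] bt_neq_tp by metis

text \<open>
  For \<open>x\<close> other than \<open>bt\<close> and the unit, \<open>tp\<close> is the join of \<open>x\<close> and the unit. So
  \<open>tp \<odot> x\<close> is the join of \<open>x \<odot> x\<close> and \<open>x\<close>, both of which lie below \<open>x \<odot> tp\<close>; and
  symmetrically.
\<close>

lemma tp_central:
  assumes x: "x \<in> carrier R"
  shows "tp \<odot> x = x \<odot> tp"
proof (cases "x = bt \<or> x = \<e>")
  case True
  then show ?thesis by auto
next
  case False
  have "tp \<odot> x \<sqsubseteq> x \<odot> tp"
    using fuse_tp_le(2)[OF x, of "x \<odot> tp" x \<e>] fuse_le_tp(1)[OF x x] fuse_le_tp(1)[OF x, of \<e>]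
      False unit_neq_bt x by simp
  moreover have "x \<odot> tp \<sqsubseteq> tp \<odot> x"
    using fuse_tp_le(1)[OF x, of "tp \<odot> x" x \<e>] fuse_le_tp(2)[OF x x] fuse_le_tp(2)[OF x, of \<e>]
      False unit_neq_bt x by simp
  ultimately show ?thesis using x le_antisym by simp
qed

text \<open>
  The elements with \<open>x \<odot> tp = tp\<close> become the cancellative part. The remaining ones are those
  with \<open>x \<odot> tp = x \<noteq> tp\<close>, by \<open>fuse_tp_cases\<close>.
\<close>

definition A :: "'a set" where "A = {x \<in> carrier R. x \<odot> tp = tp}"
definition B :: "'a set" where "B = carrier R - A"

abbreviation "Am \<equiv> \<lparr>carrier = A, mult = fuse R, one = unit R\<rparr>"
abbreviation "Bs \<equiv> \<lparr>carrier = B, smult = fuse R\<rparr>"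

lemma A_fuse_tp: "x \<in> A \<Longrightarrow> x \<in> carrier R" "x \<in> A \<Longrightarrow> x \<odot> tp = tp" "x \<in> A \<Longrightarrow> tp \<odot> x = tp"
  by (auto simp: A_def tp_central)

lemma B_fuse_tp: "x \<in> B \<Longrightarrow> x \<in> carrier R" "x \<in> B \<Longrightarrow> x \<odot> tp = x" "x \<in> B \<Longrightarrow> tp \<odot> x = x"
  "x \<in> B \<Longrightarrow> x \<noteq> tp" "x \<in> B \<Longrightarrow> x \<notin> A"
  using fuse_tp_cases tp_central by (auto simp: A_def B_def)

lemma bt_in_B: "bt \<in> B"
  using bt_neq_tp by (auto simp: A_def B_def)

text \<open>
  Both products lie below \<open>b\<close>, and multiplying them by \<open>tp\<close>, which absorbs \<open>a\<close>, gives \<open>b\<close>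
  back. So they cannot collapse to \<open>bt\<close>.
\<close>

lemma A_fuse_B:
  assumes a: "a \<in> A" and b: "b \<in> B"
  shows "a \<odot> b = b" "b \<odot> a = b"
proof -
  note [simp] = A_fuse_tp[OF a] B_fuse_tp(1-4)[OF b]
  have "a \<odot> b = b \<or> a \<odot> b = bt" "b \<odot> a = b \<or> b \<odot> a = bt"
    using fuse_le_tp[of b a] by (auto simp: le_iff)
  moreover have "tp \<odot> (a \<odot> b) = b" "(b \<odot> a) \<odot> tp = b"
    using fuse_assoc[of tp a b] fuse_assoc[of b a tp] by simp_all
  ultimately show "a \<odot> b = b" "b \<odot> a = b"
    using fuse_bt[OF tp_closed] by metis+
qed

lemma B_fuse_B:
  assumes x: "x \<in> B" and y: "y \<in> B"
  shows "x \<odot> y = x \<or> x \<odot> y = bt" "x \<odot> y = y \<or> x \<odot> y = bt"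
  using fuse_le_tp(1)[of x y] fuse_le_tp(2)[of y x] B_fuse_tp[OF x] B_fuse_tp[OF y] by (auto simp: le_iff)

text \<open>
  An element annihilating two distinct nonzero elements annihilates their join \<open>tp\<close>, but
  \<open>x \<odot> tp = x\<close> on \<open>B\<close>. Applied to three distinct nonzero elements of \<open>B\<close> this bounds the
  size of \<open>B\<close>; applied with \<open>x = y\<close> it yields idempotents.
\<close>

lemma B_annihilates_at_most_one:
  assumes B: "x \<in> B" "y \<in> B" "y' \<in> B" and "y \<noteq> y'" "y \<noteq> bt" "y' \<noteq> bt"
    and "x \<odot> y = bt" "x \<odot> y' = bt"
  shows "x = bt"
  using fuse_tp_le(1)[of x bt y y'] assms B_fuse_tp bt_neq_tp by (auto simp: le_iff)

text \<open>
  If \<open>x \<odot> y = x \<odot> z\<close> with \<open>y \<noteq> z\<close>, this product bounds \<open>x \<odot> tp = tp\<close>; note that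
  \<open>bt\<close> does not lie in \<open>A\<close>.
\<close>

lemma top_cancellative_A: "top_cancellative_monoid Am tp"
proof -
  have closed: "x \<odot> y \<in> A" if "x \<in> A" "y \<in> A" for x y
    using that fuse_assoc[of x y tp] by (simp add: A_def)
  have tp_A: "tp \<in> A" and unit_A: "\<e> \<in> A"
    by (simp_all add: A_def)
  have monoid: "monoid Am"
    by unfold_locales (simp_all add: closed unit_A A_fuse_tp fuse_assoc)
  have cancel: "(x \<odot> y = x \<odot> z \<and> x \<odot> z \<noteq> tp \<longrightarrow> y = z) \<and>
      (y \<odot> x = z \<odot> x \<and> z \<odot> x \<noteq> tp \<longrightarrow> y = z)"
    if xyz: "x \<in> A" "y \<in> A" "z \<in> A" for x y z
  proof (cases "y = z")
    case False
    have "y \<noteq> bt" "z \<noteq> bt"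
      using xyz bt_in_B by (auto simp: B_def)
    note tp = fuse_tp_le[OF _ _ _ _ False this]
    have "x \<odot> z = tp" if "x \<odot> y = x \<odot> z"
      using tp(1)[of x "x \<odot> z"] that xyz bt_neq_tp by (auto simp: A_fuse_tp le_iff)
    moreover have "z \<odot> x = tp" if "y \<odot> x = z \<odot> x"
      using tp(2)[of x "z \<odot> x"] that xyz bt_neq_tp by (auto simp: A_fuse_tp le_iff)
    ultimately show ?thesis by blast
  qed simp
  show ?thesis
    unfolding top_cancellative_monoid_def
    by (intro conjI monoid) (use tp_A cancel in \<open>simp_all add: A_fuse_tp\<close>)
qed

lemma semigroup_B: "semigroup_with_zero Bs bt"
proof -
  have "x \<odot> y \<in> B" if "x \<in> B" "y \<in> B" for x y
    using B_fuse_B(1)[OF that] that bt_in_B by auto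
  then show ?thesis
    by (auto simp: semigroup_with_zero_def bt_in_B B_fuse_tp fuse_assoc)
qed

lemma one_of_four_B: "one_of_four Bs bt"
proof -
  have distinct: "x \<odot> y = bt" if "x \<in> B" "y \<in> B" "x \<noteq> y" for x y
    using B_fuse_B[OF that(1,2)] that(3) by auto
  consider "B = {bt}" | b where "b \<noteq> bt" "B = {bt, b}"
    | b\<^sub>1 b\<^sub>2 where "b\<^sub>1 \<in> B" "b\<^sub>2 \<in> B" "b\<^sub>1 \<noteq> bt" "b\<^sub>2 \<noteq> bt" "b\<^sub>1 \<noteq> b\<^sub>2"
    using bt_in_B by blast
  then show ?thesis
  proof cases
    case 1
    then show ?thesis by (simp add: one_of_four_def)
  next
    case 2
    then show ?thesis using B_fuse_B(1)[of b b] by (auto simp: one_of_four_def)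
  next
    case 3
    note annihilates_two = B_annihilates_at_most_one[OF _ 3(1,2,5,3,4)]
    have zero: "b\<^sub>1 \<odot> b\<^sub>2 = bt" "b\<^sub>2 \<odot> b\<^sub>1 = bt"
      using distinct 3(1,2,5) by blast+
    have "x = bt" if "x \<in> B" "x \<noteq> b\<^sub>1" "x \<noteq> b\<^sub>2" for x
      using annihilates_two[OF that(1)] distinct[OF that(1) 3(1) that(2)]
        distinct[OF that(1) 3(2) that(3)] by blast
    then have "B = {bt, b\<^sub>1, b\<^sub>2}" using 3(1,2) bt_in_B by blast
    moreover have "b\<^sub>1 \<odot> b\<^sub>1 = b\<^sub>1"
      using annihilates_two[OF 3(1) _ zero(1)] 3(3) B_fuse_B(1)[OF 3(1,1)] by blast
    moreover have "b\<^sub>2 \<odot> b\<^sub>2 = b\<^sub>2"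
      using annihilates_two[OF 3(2) zero(2)] 3(4) B_fuse_B(1)[OF 3(2,2)] by blast
    ultimately have "b\<^sub>1 \<noteq> bt \<and> b\<^sub>2 \<noteq> bt \<and> b\<^sub>1 \<noteq> b\<^sub>2 \<and> carrier Bs = {bt, b\<^sub>1, b\<^sub>2} \<and>
        b\<^sub>1 \<star>\<^bsub>Bs\<^esub> b\<^sub>1 = b\<^sub>1 \<and> b\<^sub>2 \<star>\<^bsub>Bs\<^esub> b\<^sub>2 = b\<^sub>2 \<and> b\<^sub>1 \<star>\<^bsub>Bs\<^esub> b\<^sub>2 = bt \<and> b\<^sub>2 \<star>\<^bsub>Bs\<^esub> b\<^sub>1 = bt"
      using zero 3(3-5) by simp
    then show ?thesis unfolding one_of_four_def by blast
  qed
qed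

lemma same_algebra_decomposition: "same_algebra R (R_algebra Am Bs bt tp)"
proof -
  have AB: "A \<inter> B = {}" "A \<union> B = carrier R" by (auto simp: A_def B_def)
  interpret C: R_construction Am Bs bt tp
    using top_cancellative_A semigroup_B one_of_four_B AB by unfold_locales auto
  interpret L: lattice C.L by (rule C.lattice_L)
  have car: "carrier C.L = carrier R" using C.carrier_L AB by simp
  have fuse: "x \<odot>\<^bsub>C.L\<^esub> y = x \<odot> y" if "x \<in> carrier R" "y \<in> carrier R" for x y
  proof -
    have "x \<in> A \<or> x \<in> B" "y \<in> A \<or> y \<in> B" using that AB by auto
    then show ?thesis using AB by (auto simp: C.fuse_L A_fuse_B)
  qed
  show ?thesis
    unfolding R_algebra_def
  proof (rule same_algebra_expand_by_divisions)
    show "residuated_lattice R" ..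
    show "partial_order C.L" ..
    show "eq C.L = eq R" by (simp add: eq_is_equal L.eq_is_equal)
    show "unit C.L = unit R" by (simp add: R_monoid_def Let_def)
  qed (simp_all add: car fuse C.le_L M_lattice_def le_iff)
qed

end


section \<open>The characterization\<close>

theorem corollary2p3:
  fixes R :: "'a residuated"
  shows "residuated_lattice R \<and> (\<exists>X bt tp. based_on_M X bt tp R) \<longleftrightarrow>
    (\<exists>A B bt tp. top_cancellative_monoid A tp \<and>
       semigroup_with_zero B bt \<and> one_of_four B bt \<and>
       carrier A \<inter> carrier B = {} \<and>
       same_algebra R (R_algebra A B bt tp))"
proof
  assume "residuated_lattice R \<and> (\<exists>X bt tp. based_on_M X bt tp R)"
  then obtain X bt tp where "residuated_lattice R" "based_on_M X bt tp R" by blast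
  then interpret M_residuated_lattice R X bt tp
    by (simp add: M_residuated_lattice_def M_residuated_lattice_axioms_def)
  have "carrier Am \<inter> carrier Bs = {}" by (auto simp: B_def)
  then show "\<exists>A B bt tp. top_cancellative_monoid A tp \<and>
       semigroup_with_zero B bt \<and> one_of_four B bt \<and>
       carrier A \<inter> carrier B = {} \<and> same_algebra R (R_algebra A B bt tp)"
    using top_cancellative_A semigroup_B one_of_four_B same_algebra_decomposition by blast
next
  assume "\<exists>A B bt tp. top_cancellative_monoid A tp \<and>
       semigroup_with_zero B bt \<and> one_of_four B bt \<and>
       carrier A \<inter> carrier B = {} \<and> same_algebra R (R_algebra A B bt tp)"
  then obtain A B bt tp where C: "R_construction A B bt tp"
    and same: "same_algebra R (R_algebra A B bt tp)"
    by (auto simp: R_construction_def)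
  show "residuated_lattice R \<and> (\<exists>X bt tp. based_on_M X bt tp R)"
    using residuated_lattice_same_algebra[OF R_construction.residuated_lattice_R_algebra[OF C] same]
      R_construction.based_on_M_R_algebra[OF C same] by blast
qed

end
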